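(* Let $X$ be a set (finite or infinite), let $M=X^*$ be the free monoid on $X$, let $k$ be a semiring and let $f\in k^M$ be a function $M\to k$. The following are equivalent: (i) the family $(f_w)_{w\in M}$ of right shifts of $f$ is contained in a finitely generated shift-invariant left submodule of $k^M$; (ii) the family $({}_wf)_{w\in M}$ of left shifts of $f$ is contained in a finitely generated shift-invariant right submodule of $k^M$; (iii) there exist an integer $n$, a row $\lambda\in k^{1\times n}$, a column $\gamma\in k^{n\times 1}$ and a morphism of monoids $\mu: M\to (k^{n\times n},\times)$ such that $f(w)=\lambda\mu(w)\gamma$ for all $w\in M$; (iv) $f$ lies in the rational closure of $\overline{kX}=\{\sum_{x\in X}\alpha(x)x\;:\;\alpha\in k^X\}$, i.e. in the smallest subalgebra of $k\langle\langle X\rangle\rangle$ which is closed under the star operation and contains $\overline{kX}$.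
   Context: A semiring $(k,+,\times)$ is a set with two laws such that $(k,+)$ is a commutative monoid with neutral $0_k$, $(k,\times)$ is a monoid (not necessarily commutative) with neutral $1_k$, $\times$ distributes over $+$ on both sides, and $0_k x=x0_k=0_k$ for all $x\in k$. A (left, right) $k$-module is a commutative monoid $(N,+)$ with a morphism of semirings from $k$ to $\mathrm{End}(N)$ (respectively to its opposite). The set $k^M$ of all functions $M\to k$ is a $k$-$k$-bimodule for pointwise addition and $(\alpha g)(x)=\alpha\, g(x)$, $(g\alpha)(x)=g(x)\alpha$. The free monoid $X^*$ is the set of finite words over $X$ with concatenation; its unit is the empty word $1_{X^*}$. Shifts: for $f: M\to k$ and $a\in M$, the right shift is $f_a: x\mapsto f(ax)$ and the left shift is ${}_af: x\mapsto f(xa)$. In (i), "shift-invariant" means stable under all right shifts $g\mapsto g_a$, $a\in M$; in (ii) it means stable under all left shifts $g\mapsto {}_ag$, $a\in M$. $k\langle\langle X\rangle\rangle$ denotes $k^{X^*}$ (noncommutative formal series), a function $f$ being written $\sum_{w} f(w)w$, with the convolution (Cauchy) product $(fg)(w)=\sum_{uv=w}f(u)g(v)$, whose unit is the characteristic function of $1_{X^*}$. A subalgebra is a subset closed under addition, product, left and right scalings by $k$, and containing zero and the unit. The element $\sum_{x\in X}\alpha(x)x$ is the series with value $\alpha(x)$ at each letter $x$ and $0_k$ at all other words. Star: a family of functions $(f_i)_{i\in I}$ from $M$ to $k$ is summable if for each $m\in M$ the family $(f_i(m))_{i\in I}$ is finitely supported; its sum is $m\mapsto\sum_i f_i(m)$.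 If $f(1_{X^*})=0_k$ then $(f^n)_{n\in\mathbb N}$ (convolution powers) is summable and $f^*:=\sum_{n\in\mathbb N}f^n$. A subset is closed under the star operation if it contains $f^*$ for each of its elements $f$ with $f(1_{X^*})=0_k$. *)

theory Defs
  imports Main "HOL-Library.Groups_Big_Fun" "Jordan_Normal_Form.Matrix"
begin

text \<open>
  A (noncommutative, unital) semiring is a type of sort \<open>{semiring_0, monoid_mult}\<close>; the sort
  \<open>semiring_1\<close> would in addition exclude the zero semiring.  The free monoid on a set \<open>X\<close>
  (possibly empty) is \<open>lists X\<close> with append and unit \<open>[]\<close>.  A function from \<open>lists X\<close> to \<open>k\<close>
  is encoded by its extension by zero to all of \<open>'x list\<close>.  Since a product of two words lies in
  \<open>lists X\<close> exactly if both factors do, shifts by words of \<open>lists X\<close>, pointwise operations and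
  convolution are compatible with this encoding.
\<close>

definition series :: "'x set \<Rightarrow> ('x list \<Rightarrow> 'k::zero) set" where
  "series X = {f. \<forall>w. w \<notin> lists X \<longrightarrow> f w = 0}"

definition right_shift :: "'x list \<Rightarrow> ('x list \<Rightarrow> 'k) \<Rightarrow> 'x list \<Rightarrow> 'k" where
  "right_shift a f = (\<lambda>x. f (a @ x))"

definition left_shift :: "'x list \<Rightarrow> ('x list \<Rightarrow> 'k) \<Rightarrow> 'x list \<Rightarrow> 'k" where
  "left_shift a f = (\<lambda>x. f (x @ a))"

definition left_submodule :: "'x set \<Rightarrow> ('x list \<Rightarrow> 'k::{semiring_0,monoid_mult}) set \<Rightarrow> bool" where
  "left_submodule X N \<longleftrightarrow> N \<subseteq> series X \<and> (\<lambda>x. 0) \<in> N \<and>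
     (\<forall>g\<in>N. \<forall>h\<in>N. (\<lambda>x. g x + h x) \<in> N) \<and> (\<forall>\<alpha>. \<forall>g\<in>N. (\<lambda>x. \<alpha> * g x) \<in> N)"

definition right_submodule :: "'x set \<Rightarrow> ('x list \<Rightarrow> 'k::{semiring_0,monoid_mult}) set \<Rightarrow> bool" where
  "right_submodule X N \<longleftrightarrow> N \<subseteq> series X \<and> (\<lambda>x. 0) \<in> N \<and>
     (\<forall>g\<in>N. \<forall>h\<in>N. (\<lambda>x. g x + h x) \<in> N) \<and> (\<forall>\<alpha>. \<forall>g\<in>N. (\<lambda>x. g x * \<alpha>) \<in> N)"

text \<open>
  \<open>P hull G\<close> is the intersection of all sets that satisfy \<open>P\<close> and contain \<open>G\<close>.
\<close>

definition fg_left_submodule :: "'x set \<Rightarrow> ('x list \<Rightarrow> 'k::{semiring_0,monoid_mult}) set \<Rightarrow> bool" where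
  "fg_left_submodule X N \<longleftrightarrow>
     (\<exists>G. finite G \<and> G \<subseteq> series X \<and> N = left_submodule X hull G)"

definition fg_right_submodule :: "'x set \<Rightarrow> ('x list \<Rightarrow> 'k::{semiring_0,monoid_mult}) set \<Rightarrow> bool" where
  "fg_right_submodule X N \<longleftrightarrow>
     (\<exists>G. finite G \<and> G \<subseteq> series X \<and> N = right_submodule X hull G)"

definition right_shifts_in_fg_left_submodule ::
    "'x set \<Rightarrow> ('x list \<Rightarrow> 'k::{semiring_0,monoid_mult}) \<Rightarrow> bool" where
  "right_shifts_in_fg_left_submodule X f \<longleftrightarrow>
     (\<exists>N. fg_left_submodule X N \<and> (\<forall>g\<in>N. \<forall>a\<in>lists X. right_shift a g \<in> N) \<and>
       (\<forall>w\<in>lists X. right_shift w f \<in> N))"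

definition left_shifts_in_fg_right_submodule ::
    "'x set \<Rightarrow> ('x list \<Rightarrow> 'k::{semiring_0,monoid_mult}) \<Rightarrow> bool" where
  "left_shifts_in_fg_right_submodule X f \<longleftrightarrow>
     (\<exists>N. fg_right_submodule X N \<and> (\<forall>g\<in>N. \<forall>a\<in>lists X. left_shift a g \<in> N) \<and>
       (\<forall>w\<in>lists X. left_shift w f \<in> N))"

definition matrix_morphism ::
    "'x set \<Rightarrow> nat \<Rightarrow> ('x list \<Rightarrow> 'k::{semiring_0,monoid_mult} mat) \<Rightarrow> bool" where
  "matrix_morphism X n \<mu> \<longleftrightarrow> (\<forall>w\<in>lists X. \<mu> w \<in> carrier_mat n n) \<and> \<mu> [] = 1\<^sub>m n \<and>
     (\<forall>u\<in>lists X. \<forall>v\<in>lists X. \<mu> (u @ v) = \<mu> u * \<mu> v)"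

definition has_linear_representation ::
    "'x set \<Rightarrow> ('x list \<Rightarrow> 'k::{semiring_0,monoid_mult}) \<Rightarrow> bool" where
  "has_linear_representation X f \<longleftrightarrow>
     (\<exists>n. \<exists>\<rho> \<in> carrier_mat 1 n. \<exists>\<gamma> \<in> carrier_mat n 1. \<exists>\<mu>. matrix_morphism X n \<mu> \<and>
       (\<forall>w\<in>lists X. f w = (\<rho> * \<mu> w * \<gamma>) $$ (0, 0)))"

definition conv :: "('x list \<Rightarrow> 'k::{semiring_0,monoid_mult}) \<Rightarrow> ('x list \<Rightarrow> 'k) \<Rightarrow> 'x list \<Rightarrow> 'k" where
  "conv f g = (\<lambda>w. \<Sum>(u, v)\<in>{(u, v). u @ v = w}. f u * g v)"

definition series_unit :: "'x list \<Rightarrow> 'k::{semiring_0,monoid_mult}" where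
  "series_unit = (\<lambda>w. if w = [] then 1 else 0)"

primrec conv_power :: "('x list \<Rightarrow> 'k::{semiring_0,monoid_mult}) \<Rightarrow> nat \<Rightarrow> 'x list \<Rightarrow> 'k" where
  "conv_power f 0 = series_unit"
| "conv_power f (Suc n) = conv f (conv_power f n)"

definition summable_family :: "('i \<Rightarrow> 'x list \<Rightarrow> 'k::{semiring_0,monoid_mult}) \<Rightarrow> bool" where
  "summable_family F \<longleftrightarrow> (\<forall>w. finite {i. F i w \<noteq> 0})"

definition family_sum :: "('i \<Rightarrow> 'x list \<Rightarrow> 'k::{semiring_0,monoid_mult}) \<Rightarrow> 'x list \<Rightarrow> 'k" where
  "family_sum F = (\<lambda>w. Sum_any (\<lambda>i. F i w))"

definition series_star :: "('x list \<Rightarrow> 'k::{semiring_0,monoid_mult}) \<Rightarrow> 'x list \<Rightarrow> 'k" where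
  "series_star f = family_sum (conv_power f)"

definition series_subalgebra :: "'x set \<Rightarrow> ('x list \<Rightarrow> 'k::{semiring_0,monoid_mult}) set \<Rightarrow> bool" where
  "series_subalgebra X A \<longleftrightarrow> A \<subseteq> series X \<and> (\<lambda>w. 0) \<in> A \<and> series_unit \<in> A \<and>
     (\<forall>g\<in>A. \<forall>h\<in>A. (\<lambda>w. g w + h w) \<in> A) \<and>
     (\<forall>g\<in>A. \<forall>h\<in>A. conv g h \<in> A) \<and>
     (\<forall>\<alpha>. \<forall>g\<in>A. (\<lambda>w. \<alpha> * g w) \<in> A) \<and>
     (\<forall>\<alpha>. \<forall>g\<in>A. (\<lambda>w. g w * \<alpha>) \<in> A)"

definition star_closed :: "('x list \<Rightarrow> 'k::{semiring_0,monoid_mult}) set \<Rightarrow> bool" where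
  "star_closed A \<longleftrightarrow> (\<forall>g\<in>A. g [] = 0 \<longrightarrow> series_star g \<in> A)"

definition letter_series :: "'x set \<Rightarrow> ('x \<Rightarrow> 'k) \<Rightarrow> 'x list \<Rightarrow> 'k::{semiring_0,monoid_mult}" where
  "letter_series X \<alpha> = (\<lambda>w. case w of [x] \<Rightarrow> (if x \<in> X then \<alpha> x else 0) | _ \<Rightarrow> 0)"

definition letter_series_space :: "'x set \<Rightarrow> ('x list \<Rightarrow> 'k::{semiring_0,monoid_mult}) set" where
  "letter_series_space X = range (letter_series X)"

definition rational_closure :: "'x set \<Rightarrow> ('x list \<Rightarrow> 'k::{semiring_0,monoid_mult}) set \<Rightarrow>
    ('x list \<Rightarrow> 'k) set" where
  "rational_closure X S = (\<lambda>A. series_subalgebra X A \<and> star_closed A) hull S"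

text \<open>
  The powers of a series with zero constant term form a summable family, and the hulls used above
  are intersections of nonempty families, hence really are the smallest sets of their kind.
\<close>

lemma conv_power_eq_0:
  assumes "f [] = 0" and "length w < n"
  shows "conv_power f n w = 0"
  using assms(2)
proof (induction n arbitrary: w)
  case (Suc n)
  have "f u * conv_power f n v = 0" if "u @ v = w" for u v
  proof (cases u)
    case Nil
    then show ?thesis using assms(1) by simp
  next
    case (Cons a u')
    then have "length v < n" using that Suc.prems by auto
    then show ?thesis using Suc.IH by simp
  qed
  then show ?case by (auto simp: conv_def intro!: sum.neutral)
qed simp

lemma summable_conv_power:
  assumes "f [] = 0"
  shows "summable_family (conv_power f)"
  unfolding summable_family_def
proof
  fix w
  have "{n. conv_power f n w \<noteq> 0} \<subseteq> {..length w}"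
    using conv_power_eq_0[of f w] assms by (auto simp: not_less[symmetric])
  then show "finite {n. conv_power f n w \<noteq> 0}" by (rule finite_subset) simp
qed

lemma conv_in_series:
  assumes "f \<in> series X" "g \<in> series X"
  shows "conv f g \<in> series X"
  unfolding series_def mem_Collect_eq
proof (intro allI impI)
  fix w assume w: "w \<notin> lists X"
  have "f u * g v = 0" if "u @ v = w" for u v
  proof -
    have "u \<notin> lists X \<or> v \<notin> lists X" using w that by auto
    then show ?thesis using assms by (auto simp: series_def)
  qed
  then show "conv f g w = 0" by (auto simp: conv_def intro!: sum.neutral)
qed

lemma series_unit_in_series: "series_unit \<in> series X"
  by (auto simp: series_def series_unit_def)

lemma series_star_in_series:
  assumes "f \<in> series X"
  shows "series_star f \<in> series X"
proof -
  have "conv_power f n \<in> series X" for n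
    by (induction n) (use assms in \<open>simp_all add: conv_in_series series_unit_in_series\<close>)
  then show ?thesis
    by (simp add: series_def series_star_def family_sum_def)
qed

lemma left_submodule_hull:
  assumes "G \<subseteq> series X"
  shows "left_submodule X (left_submodule X hull G)"
proof -
  have "left_submodule X (series X)" by (auto simp: left_submodule_def series_def)
  then have "left_submodule X hull G \<subseteq> series X" using assms by (rule hull_minimal[rotated])
  then show ?thesis unfolding left_submodule_def[of X "_ hull _"]
    by (auto simp: hull_def left_submodule_def)
qed

lemma right_submodule_hull:
  assumes "G \<subseteq> series X"
  shows "right_submodule X (right_submodule X hull G)"
proof -
  have "right_submodule X (series X)" by (auto simp: right_submodule_def series_def)
  then have "right_submodule X hull G \<subseteq> series X" using assms by (rule hull_minimal[rotated])
  then show ?thesis unfolding right_submodule_def[of X "_ hull _"]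
    by (auto simp: hull_def right_submodule_def)
qed

lemma rational_closure_subalgebra:
  assumes "S \<subseteq> series X"
  shows "series_subalgebra X (rational_closure X S) \<and> star_closed (rational_closure X S)"
proof -
  have "series_subalgebra X (series X) \<and> star_closed (series X)"
    by (simp add: series_subalgebra_def star_closed_def conv_in_series series_star_in_series
          series_unit_in_series) (auto simp: series_def)
  then have "rational_closure X S \<subseteq> series X"
    unfolding rational_closure_def using assms by (rule hull_minimal[rotated])
  then show ?thesis
    by (auto simp: rational_closure_def hull_def series_subalgebra_def star_closed_def)
qed

lemma letter_series_space_subset: "letter_series_space X \<subseteq> series X"
  by (auto simp: letter_series_space_def letter_series_def series_def split: list.splits if_splits)

end

theory Submission
  imports Defs
begin

text \<open>
  The finitely generated shift-invariant left submodules yield a star-closed subalgebra, because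
  right shifts by letters act on products as twisted derivations and \<open>f\<^sup>*\<close> satisfies
  \<open>f\<^sup>* = 1 + f f\<^sup>*\<close>.  Conversely the generators of such a submodule solve a linear system whose
  coefficients are letter series, and Gaussian elimination based on Arden's rule
  (\<open>g = b + a g\<close> forces \<open>g = a\<^sup>* b\<close> if \<open>a\<close> has zero constant term) expresses them rationally.
  The matrices of a linear representation are the matrices of the shifts on the generators.
\<close>

section \<open>Convolution and Arden's rule\<close>

text \<open>Factorizations of a word correspond to its cut positions, so sums over pairs become sums
  over an initial segment of the naturals.\<close>

lemma conv_take_drop:
  fixes f g :: "'x list \<Rightarrow> 'k::{semiring_0,monoid_mult}"
  shows "conv f g w = (\<Sum>i\<le>length w. f (take i w) * g (drop i w))"
proof -
  have "bij_betw (\<lambda>i. (take i w, drop i w)) {..length w} {(u, v). u @ v = w}"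
    by (rule bij_betwI[where g = "\<lambda>(u, v). length u"]) auto
  from sum.reindex_bij_betw[OF this, of "\<lambda>(u, v). f u * g v"] show ?thesis
    by (simp add: conv_def)
qed

lemma conv_Nil:
  fixes f g :: "'x list \<Rightarrow> 'k::{semiring_0,monoid_mult}"
  shows "conv f g [] = f [] * g []"
  by (simp add: conv_take_drop)

text \<open>Splitting off the cut with empty prefix gives a recursion along the word, in which the
  shift replaces the left factor.\<close>

lemma conv_Cons:
  fixes f g :: "'x list \<Rightarrow> 'k::{semiring_0,monoid_mult}"
  shows "conv f g (x # w) = f [] * g (x # w) + conv (right_shift [x] f) g w"
  by (simp add: conv_take_drop right_shift_def sum.atMost_Suc_shift del: sum.atMost_Suc)

text \<open>This is the twisted Leibniz rule: in the term where \<open>g\<close> is shifted,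
  \<open>f\<close> is replaced by its constant term.\<close>

lemma right_shift_conv:
  fixes f g :: "'x list \<Rightarrow> 'k::{semiring_0,monoid_mult}"
  shows "right_shift [x] (conv f g) = (\<lambda>w. f [] * right_shift [x] g w + conv (right_shift [x] f) g w)"
  by (simp add: right_shift_def conv_Cons)

lemma conv_add_left:
  fixes f g h :: "'x list \<Rightarrow> 'k::{semiring_0,monoid_mult}"
  shows "conv (\<lambda>w. f w + g w) h = (\<lambda>w. conv f h w + conv g h w)"
  by (simp add: conv_take_drop fun_eq_iff distrib_right sum.distrib)

lemma conv_scale_left:
  fixes f g :: "'x list \<Rightarrow> 'k::{semiring_0,monoid_mult}"
  shows "conv (\<lambda>w. c * f w) g = (\<lambda>w. c * conv f g w)"
  by (simp add: conv_take_drop fun_eq_iff sum_distrib_left mult.assoc)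

lemma conv_zero_left:
  fixes g :: "'x list \<Rightarrow> 'k::{semiring_0,monoid_mult}"
  shows "conv (\<lambda>w. 0) g = (\<lambda>w. 0)"
  by (simp add: conv_take_drop fun_eq_iff)

lemma conv_unit_left:
  fixes g :: "'x list \<Rightarrow> 'k::{semiring_0,monoid_mult}"
  shows "conv series_unit g = g"
proof
  fix w show "conv series_unit g w = g w"
    by (cases w) (simp_all add: conv_Nil conv_Cons series_unit_def right_shift_def conv_zero_left)
qed

lemma conv_add_right:
  fixes f g h :: "'x list \<Rightarrow> 'k::{semiring_0,monoid_mult}"
  shows "conv f (\<lambda>w. g w + h w) = (\<lambda>w. conv f g w + conv f h w)"
  by (simp add: conv_take_drop fun_eq_iff distrib_left sum.distrib)

lemma conv_sum_right:
  fixes f :: "'x list \<Rightarrow> 'k::{semiring_0,monoid_mult}"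
  shows "conv f (\<lambda>w. \<Sum>i\<in>I. g i w) w = (\<Sum>i\<in>I. conv f (g i) w)"
  by (simp add: conv_take_drop sum_distrib_left) (rule sum.swap)

text \<open>Right scaling becomes a product, so that closure under products will cover it.\<close>

lemma conv_scaled_unit_right:
  fixes f :: "'x list \<Rightarrow> 'k::{semiring_0,monoid_mult}"
  shows "conv f (\<lambda>w. c * series_unit w) = (\<lambda>w. f w * c)"
proof
  fix w show "conv f (\<lambda>w. c * series_unit w) w = f w * c"
    by (induction w arbitrary: f) (simp_all add: conv_Nil conv_Cons series_unit_def right_shift_def)
qed

text \<open>By the Leibniz rule both sides obey the same recursion, with \<open>f\<close> replaced
  by its shift in the tail; hence \<open>f\<close> varies in the induction.\<close>

lemma conv_assoc:
  fixes f g h :: "'x list \<Rightarrow> 'k::{semiring_0,monoid_mult}"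
  shows "conv (conv f g) h = conv f (conv g h)"
proof
  fix w show "conv (conv f g) h w = conv f (conv g h) w"
    by (induction w arbitrary: f g)
       (simp_all add: conv_Nil conv_Cons right_shift_conv conv_add_left conv_scale_left
          mult.assoc distrib_left add.assoc)
qed

section \<open>The star and linear equations in one unknown\<close>

lemma conv_cong_le:
  fixes f g h :: "'x list \<Rightarrow> 'k::{semiring_0,monoid_mult}"
  assumes "\<And>v. length v \<le> length w \<Longrightarrow> g v = h v"
  shows "conv f g w = conv f h w"
  by (simp add: conv_take_drop assms)

text \<open>Powers beyond \<open>length w\<close> vanish at \<open>w\<close>. The bound stays free
  because the unfolding of the star needs it at two sizes.\<close>

lemma series_star_eq_sum:
  fixes f :: "'x list \<Rightarrow> 'k::{semiring_0,monoid_mult}"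
  assumes "f [] = 0" and "length w \<le> N"
  shows "series_star f w = (\<Sum>n\<le>N. conv_power f n w)"
  unfolding series_star_def family_sum_def
proof (rule Sum_any.expand_superset)
  show "{n. conv_power f n w \<noteq> 0} \<subseteq> {..N}"
    using conv_power_eq_0[of f w] assms by (auto simp: not_less[symmetric])
qed simp

lemma series_star_unfold:
  fixes f :: "'x list \<Rightarrow> 'k::{semiring_0,monoid_mult}"
  assumes "f [] = 0"
  shows "series_star f = (\<lambda>w. series_unit w + conv f (series_star f) w)"
proof
  fix w
  \<comment> \<open>The bound exceeds the length by one, so that \<open>length w\<close> is still
    available after the zeroth power is removed.\<close>
  have "series_star f w = (\<Sum>n\<le>Suc (length w). conv_power f n w)"
    using assms by (simp only: series_star_eq_sum[where N = "Suc (length w)"] le_SucI order_refl)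
  also have "\<dots> = series_unit w + conv f (\<lambda>w'. \<Sum>n\<le>length w. conv_power f n w') w"
    by (simp only: sum.atMost_Suc_shift conv_power.simps conv_sum_right)
  \<comment> \<open>The convolution at \<open>w\<close> sees its right factor only on words of
    length at most \<open>length w\<close>, where the truncated sum already equals the star.\<close>
  also have "conv f (\<lambda>w'. \<Sum>n\<le>length w. conv_power f n w') w = conv f (series_star f) w"
    by (rule conv_cong_le) (simp add: series_star_eq_sum[of f _ "length w", OF assms])
  finally show "series_star f w = series_unit w + conv f (series_star f) w" .
qed

text \<open>As \<open>a\<close> has zero constant term, \<open>conv a g w\<close> involves
  \<open>g\<close> only at words shorter than \<open>w\<close>, so the equation determines
  \<open>g\<close> by recursion on the length. No subtraction is used.\<close>

lemma linear_equation_unique: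
  fixes a b g h :: "'x list \<Rightarrow> 'k::{semiring_0,monoid_mult}"
  assumes a: "a [] = 0"
    and g: "\<And>w. g w = b w + conv a g w" and h: "\<And>w. h w = b w + conv a h w"
  shows "g w = h w"
proof (induction w rule: length_induct)
  case (1 w)
  have "conv a g w = conv a h w"
  proof (cases w)
    case Nil
    then show ?thesis using a by (simp add: conv_Nil)
  next
    case (Cons x v)
    have "conv (right_shift [x] a) g v = conv (right_shift [x] a) h v"
      by (rule conv_cong_le) (use 1 Cons in auto)
    then show ?thesis using a Cons by (simp add: conv_Cons)
  qed
  then show ?case by (simp only: g[of w] h[of w])
qed

text \<open>The unfolding of the star shows that \<open>conv (series_star a) b\<close> solves the
  same equation, and solutions are unique.\<close>

lemma Arden:
  fixes a b g :: "'x list \<Rightarrow> 'k::{semiring_0,monoid_mult}"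
  assumes a: "a [] = 0" and g: "g = (\<lambda>w. b w + conv a g w)"
  shows "g = conv (series_star a) b"
proof
  fix w
  have "conv (series_star a) b = conv (\<lambda>w. series_unit w + conv a (series_star a) w) b"
    by (rule arg_cong[OF series_star_unfold[of a, OF a]])
  also have "\<dots> = (\<lambda>w. b w + conv a (conv (series_star a) b) w)"
    by (simp add: conv_add_left conv_unit_left conv_assoc)
  finally have s: "conv (series_star a) b v = b v + conv a (conv (series_star a) b) v" for v
    by (rule fun_cong)
  show "g w = conv (series_star a) b w"
    by (rule linear_equation_unique[of a g b, OF a fun_cong[OF g] s])
qed

section \<open>Systems of linear equations over a star-closed subalgebra\<close>

lemma series_subalgebra_sum:
  assumes "series_subalgebra X A" and "\<And>i. i \<in> I \<Longrightarrow> g i \<in> A"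
  shows "(\<lambda>w. \<Sum>i\<in>I. g i w) \<in> A"
  using assms(2)
proof (induction I rule: infinite_finite_induct)
  case (insert i I)
  then have "(\<lambda>w. g i w + (\<Sum>i\<in>I. g i w)) \<in> A"
    using assms(1) by (auto simp: series_subalgebra_def)
  then show ?case using insert by simp
qed (use assms(1) in \<open>simp_all add: series_subalgebra_def\<close>)

text \<open>Gaussian elimination: Arden's rule solves one equation for its own unknown, and
  substitution leaves a smaller system for the same \<open>g\<close> with new \<open>a\<close> and
  \<open>b\<close>. Coefficients always stand left of the unknowns, so commutativity never
  enters.\<close>

lemma linear_system_solution_in:
  fixes A :: "('x list \<Rightarrow> 'k::{semiring_0,monoid_mult}) set"
  assumes A: "series_subalgebra X A" "star_closed A" and "finite I"
    and "\<And>i. i \<in> I \<Longrightarrow> b i \<in> A" and "\<And>i j. i \<in> I \<Longrightarrow> j \<in> I \<Longrightarrow> a i j \<in> A \<and> a i j [] = 0"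
    and "\<And>i. i \<in> I \<Longrightarrow> g i = (\<lambda>w. b i w + (\<Sum>j\<in>I. conv (a i j) (g j) w))"
    and "i \<in> I"
  shows "g i \<in> A"
  using assms(3-)
proof (induction I arbitrary: a b i rule: finite_induct)
  case empty
  then show ?case by simp
next
  case (insert n I)
  have add: "(\<lambda>w. h w + h' w) \<in> A" if "h \<in> A" "h' \<in> A" for h h'
    using A(1) that by (auto simp: series_subalgebra_def)
  have cnv: "conv h h' \<in> A" if "h \<in> A" "h' \<in> A" for h h'
    using A(1) that by (auto simp: series_subalgebra_def)
  define s where "s = series_star (a n n)"
  have s: "s \<in> A" using A(2) insert.prems(2)[of n n] by (simp add: s_def star_closed_def)
  have "g n = (\<lambda>w. b n w + (\<Sum>j\<in>insert n I. conv (a n j) (g j) w))"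
    by (rule insert.prems(3)) simp
  also have "\<dots> = (\<lambda>w. (b n w + (\<Sum>j\<in>I. conv (a n j) (g j) w)) + conv (a n n) (g n) w)"
    using insert.hyps by (simp add: ac_simps)
  finally have "g n = conv s (\<lambda>w. b n w + (\<Sum>j\<in>I. conv (a n j) (g j) w))"
    unfolding s_def by (rule Arden[rotated]) (use insert.prems(2)[of n n] in simp)
  then have gn: "g n = (\<lambda>w. conv s (b n) w + (\<Sum>j\<in>I. conv (conv s (a n j)) (g j) w))"
    by (simp add: conv_add_right conv_sum_right conv_assoc)
  have gI: "g i \<in> A" if "i \<in> I" for i
  \<comment> \<open>These are the data of the reduced system. The new coefficients again have zero
    constant term because both \<open>a i j\<close> and \<open>a i n\<close> do.\<close>
  proof (rule insert.IH[of "\<lambda>i w. b i w + conv (a i n) (conv s (b n)) w"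
        "\<lambda>i j w. a i j w + conv (a i n) (conv s (a n j)) w", OF _ _ _ that])
    fix i assume i: "i \<in> I"
    have "g i = (\<lambda>w. b i w + (\<Sum>j\<in>insert n I. conv (a i j) (g j) w))"
      by (rule insert.prems(3)) (simp add: i)
    also have "\<dots> = (\<lambda>w. b i w + (conv (a i n) (g n) w + (\<Sum>j\<in>I. conv (a i j) (g j) w)))"
      using insert.hyps by simp
    also have "conv (a i n) (g n) = (\<lambda>w. conv (a i n) (conv s (b n)) w
        + (\<Sum>j\<in>I. conv (conv (a i n) (conv s (a n j))) (g j) w))"
      by (subst gn) (simp add: conv_add_right conv_sum_right conv_assoc)
    finally show "g i = (\<lambda>w. (b i w + conv (a i n) (conv s (b n)) w) +
        (\<Sum>j\<in>I. conv (\<lambda>w. a i j w + conv (a i n) (conv s (a n j)) w) (g j) w))"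
      by (simp add: conv_add_left sum.distrib ac_simps)
  qed (use insert.prems(1,2) s in \<open>auto intro!: add cnv simp: conv_Nil\<close>)
  have "b n \<in> A" "a n j \<in> A" if "j \<in> I" for j
    using insert.prems(1,2) that by auto
  \<comment> \<open>Back-substitution: the eliminated unknown is recovered from the others.\<close>
  then have "g n \<in> A"
    by (subst gn) (intro add cnv series_subalgebra_sum[OF A(1)] s gI insert.prems(1); simp)
  then show ?case using gI insert.prems(4) by auto
qed

section \<open>Finitely generated shift-invariant submodules\<close>

text \<open>The members are indexed, so repetitions are allowed; this matters when generators are
  the entries of a vector.\<close>

lemma left_submodule_sum:
  assumes "left_submodule X N" and "\<And>i. i \<in> I \<Longrightarrow> g i \<in> N"
  shows "(\<lambda>w. \<Sum>i\<in>I. c i * g i w) \<in> N"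
  using assms(2)
proof (induction I rule: infinite_finite_induct)
  case (insert i I)
  then have "(\<lambda>w. c i * g i w) \<in> N" "(\<lambda>w. \<Sum>i\<in>I. c i * g i w) \<in> N"
    using assms(1) by (auto simp: left_submodule_def)
  then have "(\<lambda>w. c i * g i w + (\<Sum>i\<in>I. c i * g i w)) \<in> N"
    using assms(1) by (auto simp: left_submodule_def)
  then show ?case using insert by simp
qed (use assms(1) in \<open>simp_all add: left_submodule_def\<close>)

lemma right_submodule_sum:
  assumes "right_submodule X N" and "\<And>i. i \<in> I \<Longrightarrow> g i \<in> N"
  shows "(\<lambda>w. \<Sum>i\<in>I. g i w * c i) \<in> N"
  using assms(2)
proof (induction I rule: infinite_finite_induct)
  case (insert i I)
  then have "(\<lambda>w. g i w * c i) \<in> N" "(\<lambda>w. \<Sum>i\<in>I. g i w * c i) \<in> N"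
    using assms(1) by (auto simp: right_submodule_def)
  then have "(\<lambda>w. g i w * c i + (\<Sum>i\<in>I. g i w * c i)) \<in> N"
    using assms(1) by (auto simp: right_submodule_def)
  then show ?case using insert by simp
qed (use assms(1) in \<open>simp_all add: right_submodule_def\<close>)

text \<open>The linear combinations of \<open>G\<close> form a submodule containing
  \<open>G\<close>. Coefficients need not be unique, so one choice is fixed for every element of the
  hull.\<close>

lemma left_submodule_hull_coefficients:
  assumes G: "finite G" "G \<subseteq> series X"
  shows "\<exists>c. \<forall>f\<in>left_submodule X hull G. f = (\<lambda>w. \<Sum>g\<in>G. c f g * g w)"
proof -
  have "left_submodule X hull G \<subseteq> {f. \<exists>c. f = (\<lambda>w. \<Sum>g\<in>G. c g * g w)}" (is "_ \<subseteq> ?S")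
  proof (rule hull_minimal)
    have "g \<in> ?S" if "g \<in> G" for g
      using that G(1)
      by (intro CollectI exI[of _ "\<lambda>h. if h = g then 1 else 0"])
         (simp add: if_distrib[of "\<lambda>c. c * _"] cong: if_cong)
    then show "G \<subseteq> ?S" by blast
    have "\<exists>c. (\<lambda>x. 0) = (\<lambda>w. \<Sum>g\<in>G. c g * g w)"
      by (rule exI[of _ "\<lambda>g. 0"]) simp
    moreover have "\<exists>c. (\<lambda>w. (\<Sum>g\<in>G. c1 g * g w) + (\<Sum>g\<in>G. c2 g * g w)) = (\<lambda>w. \<Sum>g\<in>G. c g * g w)"
      for c1 c2
      by (rule exI[of _ "\<lambda>g. c1 g + c2 g"]) (simp add: distrib_right sum.distrib)
    moreover have "\<exists>c. (\<lambda>w. \<alpha> * (\<Sum>g\<in>G. c1 g * g w)) = (\<lambda>w. \<Sum>g\<in>G. c g * g w)" for \<alpha> c1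
      by (rule exI[of _ "\<lambda>g. \<alpha> * c1 g"]) (simp add: mult.assoc sum_distrib_left)
    ultimately show "left_submodule X ?S"
      using G(2) by (fastforce simp: left_submodule_def series_def intro!: sum.neutral)
  qed
  then have "\<forall>f\<in>left_submodule X hull G. \<exists>c. f = (\<lambda>w. \<Sum>g\<in>G. c g * g w)" by blast
  then show ?thesis by (rule bchoice)
qed

lemma right_submodule_hull_coefficients:
  assumes G: "finite G" "G \<subseteq> series X"
  shows "\<exists>c. \<forall>f\<in>right_submodule X hull G. f = (\<lambda>w. \<Sum>g\<in>G. g w * c f g)"
proof -
  have "right_submodule X hull G \<subseteq> {f. \<exists>c. f = (\<lambda>w. \<Sum>g\<in>G. g w * c g)}" (is "_ \<subseteq> ?S")
  proof (rule hull_minimal)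
    have "g \<in> ?S" if "g \<in> G" for g
      using that G(1)
      by (intro CollectI exI[of _ "\<lambda>h. if h = g then 1 else 0"])
         (simp add: if_distrib[of "\<lambda>c. _ * c"] cong: if_cong)
    then show "G \<subseteq> ?S" by blast
    have "\<exists>c. (\<lambda>x. 0) = (\<lambda>w. \<Sum>g\<in>G. g w * c g)"
      by (rule exI[of _ "\<lambda>g. 0"]) simp
    moreover have "\<exists>c. (\<lambda>w. (\<Sum>g\<in>G. g w * c1 g) + (\<Sum>g\<in>G. g w * c2 g)) = (\<lambda>w. \<Sum>g\<in>G. g w * c g)"
      for c1 c2
      by (rule exI[of _ "\<lambda>g. c1 g + c2 g"]) (simp add: distrib_left sum.distrib)
    moreover have "\<exists>c. (\<lambda>w. (\<Sum>g\<in>G. g w * c1 g) * \<alpha>) = (\<lambda>w. \<Sum>g\<in>G. g w * c g)" for \<alpha> c1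
      by (rule exI[of _ "\<lambda>g. c1 g * \<alpha>"]) (simp add: mult.assoc sum_distrib_right)
    ultimately show "right_submodule X ?S"
      using G(2) by (fastforce simp: right_submodule_def series_def intro!: sum.neutral)
  qed
  then have "\<forall>f\<in>right_submodule X hull G. \<exists>c. f = (\<lambda>w. \<Sum>g\<in>G. g w * c g)" by blast
  then show ?thesis by (rule bchoice)
qed

section \<open>Reduction of shift invariance to generators and letters\<close>

text \<open>Shifts are left linear, and a shift by a word is a composition of shifts by letters;
  hence invariance can be tested on generators and letters.\<close>

lemma right_shifts_in_fg_left_submodule_iff:
  fixes f :: "'x list \<Rightarrow> 'k::{semiring_0,monoid_mult}"
  shows "right_shifts_in_fg_left_submodule X f \<longleftrightarrow>
    (\<exists>G. finite G \<and> G \<subseteq> series X \<and> f \<in> left_submodule X hull G \<and>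
       (\<forall>g\<in>G. \<forall>x\<in>X. right_shift [x] g \<in> left_submodule X hull G))" (is "?L \<longleftrightarrow> ?R")
proof
  assume ?L
  then obtain G where G: "finite G" "G \<subseteq> series X"
    and st: "\<forall>g\<in>left_submodule X hull G. \<forall>a\<in>lists X. right_shift a g \<in> left_submodule X hull G"
    and f: "\<forall>w\<in>lists X. right_shift w f \<in> left_submodule X hull G"
    by (auto simp: right_shifts_in_fg_left_submodule_def fg_left_submodule_def)
  have "right_shift [] f = f" by (simp add: right_shift_def)
  then have "f \<in> left_submodule X hull G" using f by (metis lists.Nil)
  moreover have "right_shift [x] g \<in> left_submodule X hull G" if "g \<in> G" "x \<in> X" for g x
    using st that hull_inc[of g G "left_submodule X"] by simp
  ultimately show ?R using G by blast
next
  assume ?R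
  then obtain G where G: "finite G" "G \<subseteq> series X" and f: "f \<in> left_submodule X hull G"
    and st: "\<And>g x. g \<in> G \<Longrightarrow> x \<in> X \<Longrightarrow> right_shift [x] g \<in> left_submodule X hull G"
    by blast
  note N = left_submodule_hull[OF G(2)]
  have "left_submodule X hull G \<subseteq> {g \<in> series X. \<forall>x\<in>X. right_shift [x] g \<in> left_submodule X hull G}"
    (is "_ \<subseteq> ?S")
  proof (rule hull_minimal)
    show "G \<subseteq> ?S" using G(2) st by blast
    show "left_submodule X ?S"
      using N by (auto simp: left_submodule_def right_shift_def series_def)
  qed
  then have 1: "right_shift [x] g \<in> left_submodule X hull G"
    if "g \<in> left_submodule X hull G" "x \<in> X" for x g
    using that by blast
  have "right_shift a g \<in> left_submodule X hull G"
    if "a \<in> lists X" "g \<in> left_submodule X hull G" for a g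
    using that
  proof (induction arbitrary: g)
    case (Cons x a)
    have "right_shift (x # a) g = right_shift a (right_shift [x] g)" by (simp add: right_shift_def)
    then show ?case using Cons 1 by simp
  qed (simp add: right_shift_def)
  then show ?L
    unfolding right_shifts_in_fg_left_submodule_def fg_left_submodule_def using G f by blast
qed

lemma left_shifts_in_fg_right_submodule_iff:
  fixes f :: "'x list \<Rightarrow> 'k::{semiring_0,monoid_mult}"
  shows "left_shifts_in_fg_right_submodule X f \<longleftrightarrow>
    (\<exists>G. finite G \<and> G \<subseteq> series X \<and> f \<in> right_submodule X hull G \<and>
       (\<forall>g\<in>G. \<forall>x\<in>X. left_shift [x] g \<in> right_submodule X hull G))" (is "?L \<longleftrightarrow> ?R")
proof
  assume ?L
  then obtain G where G: "finite G" "G \<subseteq> series X"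
    and st: "\<forall>g\<in>right_submodule X hull G. \<forall>a\<in>lists X. left_shift a g \<in> right_submodule X hull G"
    and f: "\<forall>w\<in>lists X. left_shift w f \<in> right_submodule X hull G"
    by (auto simp: left_shifts_in_fg_right_submodule_def fg_right_submodule_def)
  have "left_shift [] f = f" by (simp add: left_shift_def)
  then have "f \<in> right_submodule X hull G" using f by (metis lists.Nil)
  moreover have "left_shift [x] g \<in> right_submodule X hull G" if "g \<in> G" "x \<in> X" for g x
    using st that hull_inc[of g G "right_submodule X"] by simp
  ultimately show ?R using G by blast
next
  assume ?R
  then obtain G where G: "finite G" "G \<subseteq> series X" and f: "f \<in> right_submodule X hull G"
    and st: "\<And>g x. g \<in> G \<Longrightarrow> x \<in> X \<Longrightarrow> left_shift [x] g \<in> right_submodule X hull G"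
    by blast
  note N = right_submodule_hull[OF G(2)]
  have "right_submodule X hull G \<subseteq> {g \<in> series X. \<forall>x\<in>X. left_shift [x] g \<in> right_submodule X hull G}"
    (is "_ \<subseteq> ?S")
  proof (rule hull_minimal)
    show "G \<subseteq> ?S" using G(2) st by blast
    show "right_submodule X ?S"
      using N by (auto simp: right_submodule_def left_shift_def series_def)
  qed
  then have 1: "left_shift [x] g \<in> right_submodule X hull G"
    if "g \<in> right_submodule X hull G" "x \<in> X" for x g
    using that by blast
  have "left_shift a g \<in> right_submodule X hull G"
    if "a \<in> lists X" "g \<in> right_submodule X hull G" for a g
    using that
  proof (induction arbitrary: g)
    case (Cons x a)
    \<comment> \<open>Left shifts compose in the opposite order: the tail \<open>a\<close> acts
      first, so the induction hypothesis precedes the letter step.\<close>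
    have "left_shift (x # a) g = left_shift [x] (left_shift a g)" by (simp add: left_shift_def)
    then show ?case using Cons 1 by simp
  qed (simp add: left_shift_def)
  then show ?L
    unfolding left_shifts_in_fg_right_submodule_def fg_right_submodule_def using G f by blast
qed

section \<open>Rational series\<close>

text \<open>Sorting nonempty words by their first letter, each generator is its constant term plus a
  sum of letter series times generators. The system is finite even over an infinite alphabet, since
  one letter series collects the coefficients of all letters.\<close>

lemma shift_invariant_imp_rational:
  fixes f :: "'x list \<Rightarrow> 'k::{semiring_0,monoid_mult}"
  assumes "right_shifts_in_fg_left_submodule X f"
  shows "f \<in> rational_closure X (letter_series_space X)"
proof -
  define A :: "('x list \<Rightarrow> 'k) set" where "A = rational_closure X (letter_series_space X)"
  have A: "series_subalgebra X A" "star_closed A"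
    unfolding A_def using rational_closure_subalgebra[OF letter_series_space_subset] by auto
  have letters: "letter_series X \<alpha> \<in> A" for \<alpha> :: "'x \<Rightarrow> 'k"
    unfolding A_def rational_closure_def by (rule hull_inc) (simp add: letter_series_space_def)
  obtain G where G: "finite G" "G \<subseteq> series X" and f: "f \<in> left_submodule X hull G"
    and st: "\<And>g x. g \<in> G \<Longrightarrow> x \<in> X \<Longrightarrow> right_shift [x] g \<in> left_submodule X hull G"
    using assms unfolding right_shifts_in_fg_left_submodule_iff by blast
  obtain C where C: "\<And>f. f \<in> left_submodule X hull G \<Longrightarrow> f = (\<lambda>w. \<Sum>g\<in>G. C f g * g w)"
    using left_submodule_hull_coefficients[OF G] by blast
  \<comment> \<open>These are the structure constants of the action: the coefficient of the
    generator \<open>h\<close> in the shift of \<open>g\<close> by the letter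
    \<open>x\<close>.\<close>
  define c where "c = (\<lambda>g x. C (right_shift [x] g))"
  have c: "g (x # w) = (\<Sum>h\<in>G. c g x h * h w)" if "g \<in> G" "x \<in> X" for g x w
    using fun_cong[OF C[OF st[OF that]], of w] by (simp add: c_def right_shift_def)
  have "g \<in> A" if "g \<in> G" for g
  \<comment> \<open>The unknowns are the generators, indexed by themselves.\<close>
  proof (rule linear_system_solution_in[OF A G(1), of "\<lambda>g w. g [] * series_unit w"
        "\<lambda>g h. letter_series X (\<lambda>x. c g x h)" "\<lambda>g. g", OF _ _ _ that])
    fix g assume g: "g \<in> G"
    show "(\<lambda>w. g [] * series_unit w) \<in> A" using A(1) by (auto simp: series_subalgebra_def)
    have letters0: "letter_series X \<alpha> [] = 0" for \<alpha> :: "'x \<Rightarrow> 'k"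
      by (simp add: letter_series_def)
    show "letter_series X (\<lambda>x. c g x h) \<in> A \<and> letter_series X (\<lambda>x. c g x h) [] = 0" for h
      using letters letters0 by simp
    have rs: "right_shift [x] (letter_series X \<alpha>) = (\<lambda>w. (if x \<in> X then \<alpha> x else 0) * series_unit w)"
      for x and \<alpha> :: "'x \<Rightarrow> 'k"
      by (auto simp: right_shift_def letter_series_def series_unit_def split: list.splits)
    show "g = (\<lambda>w. g [] * series_unit w + (\<Sum>h\<in>G. conv (letter_series X (\<lambda>x. c g x h)) h w))"
    proof
      fix w
      show "g w = g [] * series_unit w + (\<Sum>h\<in>G. conv (letter_series X (\<lambda>x. c g x h)) h w)"
      proof (cases w)
        case Nil
        then show ?thesis by (simp add: series_unit_def conv_Nil letters0)
      next
        case (Cons x v)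
        \<comment> \<open>For \<open>x\<close> outside \<open>X\<close> both sides vanish: the left
          one because \<open>g\<close> lies in \<open>series X\<close>, the right one by the default
          of the conditional.\<close>
        have "g (x # v) = (\<Sum>h\<in>G. (if x \<in> X then c g x h else 0) * h v)"
          using c[OF g, of x v] g G(2) by (cases "x \<in> X") (auto simp: series_def)
        moreover have "series_unit (x # v) = (0 :: 'k)" by (simp add: series_unit_def)
        ultimately show ?thesis using Cons
          by (simp add: conv_Cons rs conv_scale_left conv_unit_left letters0)
      qed
    qed
  qed
  \<comment> \<open>A subalgebra is in particular a left submodule, so it contains what its elements
    generate.\<close>
  then have "left_submodule X hull G \<subseteq> A"
    using A(1) by (intro hull_minimal) (auto simp: left_submodule_def series_subalgebra_def)
  then show ?thesis using f by (auto simp: A_def)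
qed

section \<open>Closure of the shift condition under the rational operations\<close>

text \<open>Right multiplication by \<open>h\<close> is left linear, so it suffices to look at
  generators.\<close>

lemma conv_in_left_submodule:
  assumes "left_submodule X N" and "h \<in> series X" and "G \<subseteq> series X"
    and "\<And>g. g \<in> G \<Longrightarrow> conv g h \<in> N" and "f \<in> left_submodule X hull G"
  shows "conv f h \<in> N"
proof -
  have "left_submodule X hull G \<subseteq> {g \<in> series X. conv g h \<in> N}" (is "_ \<subseteq> ?S")
  proof (rule hull_minimal)
    show "left_submodule X ?S"
      using assms(1,2)
      by (auto simp: left_submodule_def conv_add_left conv_scale_left conv_zero_left series_def)
  qed (use assms in blast)
  then show ?thesis using assms(5) by blast
qed

text \<open>By the Leibniz rule, the products of the generators for \<open>f\<close> with
  \<open>h\<close>, together with the generators for \<open>h\<close>, span a shift-invariant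
  module.\<close>

lemma shift_invariant_conv:
  assumes "right_shifts_in_fg_left_submodule X f" "right_shifts_in_fg_left_submodule X h"
  shows "right_shifts_in_fg_left_submodule X (conv f h)"
proof -
  obtain G where G: "finite G" "G \<subseteq> series X" and f: "f \<in> left_submodule X hull G"
    and stG: "\<And>g x. g \<in> G \<Longrightarrow> x \<in> X \<Longrightarrow> right_shift [x] g \<in> left_submodule X hull G"
    using assms(1) unfolding right_shifts_in_fg_left_submodule_iff by blast
  obtain H where H: "finite H" "H \<subseteq> series X" and h: "h \<in> left_submodule X hull H"
    and stH: "\<And>g x. g \<in> H \<Longrightarrow> x \<in> X \<Longrightarrow> right_shift [x] g \<in> left_submodule X hull H"
    using assms(2) unfolding right_shifts_in_fg_left_submodule_iff by blast
  have hX: "h \<in> series X"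
    using h left_submodule_hull[OF H(2)] by (auto simp: left_submodule_def)
  define K where "K = (\<lambda>g. conv g h) ` G \<union> H"
  have K: "finite K" "K \<subseteq> series X"
    using G H hX by (auto simp: K_def intro: conv_in_series)
  define N where "N = left_submodule X hull K"
  have N: "left_submodule X N" unfolding N_def by (rule left_submodule_hull[OF K(2)])
  have HN: "left_submodule X hull H \<subseteq> N" unfolding N_def by (rule hull_mono) (auto simp: K_def)
  have GN: "conv g h \<in> N" if "g \<in> left_submodule X hull G" for g
    by (rule conv_in_left_submodule[OF N hX G(2) _ that]) (simp add: N_def K_def hull_inc)
  have "right_shift [x] h \<in> left_submodule X hull H" if "x \<in> X" for x
  proof -
    have "left_submodule X hull H \<subseteq> {g \<in> series X. right_shift [x] g \<in> left_submodule X hull H}"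
      using left_submodule_hull[OF H(2)] H(2) stH that
      by (intro hull_minimal) (auto simp: left_submodule_def right_shift_def series_def)
    then show ?thesis using h by blast
  qed
  then have hN: "right_shift [x] h \<in> N" if "x \<in> X" for x using that HN by blast
  have "right_shift [x] (conv g h) \<in> N" if "g \<in> G" "x \<in> X" for g x
    unfolding right_shift_conv using N hN[OF that(2)] GN[OF stG[OF that]]
    by (auto simp: left_submodule_def)
  then have "\<forall>g\<in>K. \<forall>x\<in>X. right_shift [x] g \<in> N"
    using stH HN by (auto simp: K_def)
  then show ?thesis
    unfolding right_shifts_in_fg_left_submodule_iff using K GN[OF f] N_def by blast
qed

text \<open>As \<open>f [] = 0\<close>, the twisted term disappears and the shift of the star is the
  shift of \<open>f\<close> times the star. So the star and its products with the generators for
  \<open>f\<close> span an invariant module.\<close>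

lemma shift_invariant_star:
  assumes "right_shifts_in_fg_left_submodule X f" and f0: "f [] = 0"
  shows "right_shifts_in_fg_left_submodule X (series_star f)"
proof -
  obtain G where G: "finite G" "G \<subseteq> series X" and f: "f \<in> left_submodule X hull G"
    and stG: "\<And>g x. g \<in> G \<Longrightarrow> x \<in> X \<Longrightarrow> right_shift [x] g \<in> left_submodule X hull G"
    using assms(1) unfolding right_shifts_in_fg_left_submodule_iff by blast
  define h where "h = series_star f"
  have fX: "f \<in> series X"
    using f left_submodule_hull[OF G(2)] by (auto simp: left_submodule_def)
  then have hX: "h \<in> series X" unfolding h_def by (rule series_star_in_series)
  define K where "K = insert h ((\<lambda>g. conv g h) ` G)"
  have K: "finite K" "K \<subseteq> series X"
    using G hX by (auto simp: K_def intro: conv_in_series)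
  define N where "N = left_submodule X hull K"
  have N: "left_submodule X N" unfolding N_def by (rule left_submodule_hull[OF K(2)])
  have GN: "conv g h \<in> N" if "g \<in> left_submodule X hull G" for g
    by (rule conv_in_left_submodule[OF N hX G(2) _ that]) (simp add: N_def K_def hull_inc)
  have "right_shift [x] f \<in> left_submodule X hull G" if "x \<in> X" for x
  proof -
    have "left_submodule X hull G \<subseteq> {g \<in> series X. right_shift [x] g \<in> left_submodule X hull G}"
      using left_submodule_hull[OF G(2)] G(2) stG that
      by (intro hull_minimal) (auto simp: left_submodule_def right_shift_def series_def)
    then show ?thesis using f by blast
  qed
  moreover have "right_shift [x] h = conv (right_shift [x] f) h" for x
  proof -
    have "h (x # w) = series_unit (x # w) + conv f h (x # w)" for w
      unfolding h_def by (rule fun_cong[OF series_star_unfold[of f, OF f0]])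
    then show ?thesis using f0 by (simp add: right_shift_def fun_eq_iff conv_Cons series_unit_def)
  qed
  ultimately have hN: "right_shift [x] h \<in> N" if "x \<in> X" for x using that GN by simp
  have "right_shift [x] (conv g h) \<in> N" if "g \<in> G" "x \<in> X" for g x
    unfolding right_shift_conv using N hN[OF that(2)] GN[OF stG[OF that]]
    by (auto simp: left_submodule_def)
  then have "\<forall>g\<in>K. \<forall>x\<in>X. right_shift [x] g \<in> N"
    using hN by (auto simp: K_def)
  moreover have "h \<in> N" by (simp add: N_def K_def hull_inc)
  ultimately show ?thesis
    unfolding right_shifts_in_fg_left_submodule_iff h_def[symmetric] using K N_def by blast
qed

lemma shift_invariant_add:
  assumes "right_shifts_in_fg_left_submodule X f" "right_shifts_in_fg_left_submodule X h"
  shows "right_shifts_in_fg_left_submodule X (\<lambda>w. f w + h w)"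
proof -
  obtain G where G: "finite G" "G \<subseteq> series X" and f: "f \<in> left_submodule X hull G"
    and stG: "\<And>g x. g \<in> G \<Longrightarrow> x \<in> X \<Longrightarrow> right_shift [x] g \<in> left_submodule X hull G"
    using assms(1) unfolding right_shifts_in_fg_left_submodule_iff by blast
  obtain H where H: "finite H" "H \<subseteq> series X" and h: "h \<in> left_submodule X hull H"
    and stH: "\<And>g x. g \<in> H \<Longrightarrow> x \<in> X \<Longrightarrow> right_shift [x] g \<in> left_submodule X hull H"
    using assms(2) unfolding right_shifts_in_fg_left_submodule_iff by blast
  have sub: "left_submodule X hull G \<subseteq> left_submodule X hull (G \<union> H)"
    "left_submodule X hull H \<subseteq> left_submodule X hull (G \<union> H)"
    by (simp_all add: hull_mono)
  have "left_submodule X (left_submodule X hull (G \<union> H))"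
    using G(2) H(2) by (intro left_submodule_hull) blast
  moreover have "f \<in> left_submodule X hull (G \<union> H)" "h \<in> left_submodule X hull (G \<union> H)"
    using f h sub by auto
  ultimately have "(\<lambda>w. f w + h w) \<in> left_submodule X hull (G \<union> H)"
    unfolding left_submodule_def[of X "_ hull _"] by blast
  then show ?thesis
    unfolding right_shifts_in_fg_left_submodule_iff using G H stG stH sub
    by (intro exI[of _ "G \<union> H"]) blast
qed

lemma shift_invariant_scale_left:
  assumes "right_shifts_in_fg_left_submodule X f"
  shows "right_shifts_in_fg_left_submodule X (\<lambda>w. c * f w)"
proof -
  obtain G where G: "finite G" "G \<subseteq> series X" and f: "f \<in> left_submodule X hull G"
    and stG: "\<And>g x. g \<in> G \<Longrightarrow> x \<in> X \<Longrightarrow> right_shift [x] g \<in> left_submodule X hull G"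
    using assms unfolding right_shifts_in_fg_left_submodule_iff by blast
  have "(\<lambda>w. c * f w) \<in> left_submodule X hull G"
    using left_submodule_hull[OF G(2)] f unfolding left_submodule_def[of X "_ hull _"] by blast
  then show ?thesis unfolding right_shifts_in_fg_left_submodule_iff using G stG by blast
qed

text \<open>Two generators suffice for any alphabet: letter shifts send a letter series to a scalar
  multiple of the unit, and the unit to zero.\<close>

lemma shift_invariant_letters_unit_zero:
  fixes \<alpha> :: "'x \<Rightarrow> 'k::{semiring_0,monoid_mult}"
  shows "right_shifts_in_fg_left_submodule X (letter_series X \<alpha>)" (is ?A)
    and "right_shifts_in_fg_left_submodule X (series_unit :: 'x list \<Rightarrow> 'k)" (is ?B)
    and "right_shifts_in_fg_left_submodule X ((\<lambda>w. 0) :: 'x list \<Rightarrow> 'k)" (is ?C)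
proof -
  let ?G = "{letter_series X \<alpha>, series_unit}"
  have G: "?G \<subseteq> series X"
    using letter_series_space_subset[of X] by (auto simp: letter_series_space_def series_unit_in_series)
  note N = left_submodule_hull[OF G, unfolded left_submodule_def[of X "_ hull _"]]
  have inc: "letter_series X \<alpha> \<in> left_submodule X hull ?G" "series_unit \<in> left_submodule X hull ?G"
    by (auto intro: hull_inc)
  have "right_shift [x] (letter_series X \<alpha>) = (\<lambda>w. (if x \<in> X then \<alpha> x else 0) * series_unit w)"
    "right_shift [x] (series_unit :: 'x list \<Rightarrow> 'k) = (\<lambda>w. 0)" for x
    by (auto simp: right_shift_def letter_series_def series_unit_def split: list.splits)
  then have st: "\<forall>g\<in>?G. \<forall>x\<in>X. right_shift [x] g \<in> left_submodule X hull ?G"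
    using N inc by auto
  show ?A ?B ?C
    unfolding right_shifts_in_fg_left_submodule_iff using G st inc N
    by (intro exI[of _ ?G]; simp)+
qed

lemma rational_imp_shift_invariant:
  fixes f :: "'x list \<Rightarrow> 'k::{semiring_0,monoid_mult}"
  assumes "f \<in> rational_closure X (letter_series_space X)"
  shows "right_shifts_in_fg_left_submodule X f"
proof -
  let ?A = "{f :: 'x list \<Rightarrow> 'k. right_shifts_in_fg_left_submodule X f}"
  have "left_submodule X hull G \<subseteq> series X" if "G \<subseteq> series X" for G :: "('x list \<Rightarrow> 'k) set"
    using left_submodule_hull[OF that] unfolding left_submodule_def[of X "_ hull _"] by blast
  then have "?A \<subseteq> series X"
    unfolding right_shifts_in_fg_left_submodule_iff by blast
  \<comment> \<open>Right scaling does not come from the left module structure; it is obtained as a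
    product with a scaled unit.\<close>
  moreover have "(\<lambda>w. g w * c) \<in> ?A" if "g \<in> ?A" for g c
    using shift_invariant_conv[of X g "\<lambda>w. c * series_unit w"] that
    by (simp add: conv_scaled_unit_right shift_invariant_scale_left shift_invariant_letters_unit_zero)
  ultimately have "series_subalgebra X ?A"
    by (simp add: series_subalgebra_def shift_invariant_letters_unit_zero shift_invariant_add
        shift_invariant_conv shift_invariant_scale_left)
  moreover have "star_closed ?A" by (simp add: star_closed_def shift_invariant_star)
  moreover have "letter_series_space X \<subseteq> ?A"
    by (auto simp: letter_series_space_def shift_invariant_letters_unit_zero)
  ultimately have "rational_closure X (letter_series_space X) \<subseteq> ?A"
    unfolding rational_closure_def by (intro hull_minimal) auto
  then show ?thesis using assms by blast
qed

section \<open>Linear representations\<close>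

text \<open>The library states the unit laws of matrices only over nonzero semirings.\<close>

lemma one_mat_mult_left:
  fixes A :: "'k::{semiring_0,monoid_mult} mat"
  assumes "A \<in> carrier_mat n m"
  shows "1\<^sub>m n * A = A"
  using assms
  by (intro eq_matI) (auto simp: scalar_prod_def if_distrib[of "\<lambda>c. c * _"] cong: if_cong)

lemma one_mat_mult_right:
  fixes A :: "'k::{semiring_0,monoid_mult} mat"
  assumes "A \<in> carrier_mat n m"
  shows "A * 1\<^sub>m m = A"
  using assms
  by (intro eq_matI) (auto simp: scalar_prod_def if_distrib[of "\<lambda>c. _ * c"] cong: if_cong)

lemma mult_mat_entry:
  fixes A B :: "'k::semiring_0 mat"
  assumes "A \<in> carrier_mat n m" "B \<in> carrier_mat m p" "i < n" "j < p"
  shows "(A * B) $$ (i, j) = (\<Sum>k<m. A $$ (i, k) * B $$ (k, j))"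
  using assms by (auto simp: scalar_prod_def atLeast0LessThan)

section \<open>Matrix morphisms on the free monoid\<close>

text \<open>This is the morphism that freeness attaches to the letter matrices. Every letter of the
  type gets a matrix, so that membership in \<open>X\<close> need not be carried along.\<close>

definition word_mat ::
    "nat \<Rightarrow> ('x \<Rightarrow> 'k::{semiring_0,monoid_mult} mat) \<Rightarrow> 'x list \<Rightarrow> 'k mat" where
  "word_mat n A w = foldr (\<lambda>x B. A x * B) w (1\<^sub>m n)"

lemma word_mat_carrier:
  assumes "\<And>x. A x \<in> carrier_mat n n"
  shows "word_mat n A w \<in> carrier_mat n n"
  by (induction w) (auto simp: word_mat_def intro: mult_carrier_mat[OF assms])

lemma word_mat_append:
  assumes "\<And>x. A x \<in> carrier_mat n n"
  shows "word_mat n A (u @ v) = word_mat n A u * word_mat n A v"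
proof (induction u)
  case Nil
  show ?case using one_mat_mult_left[OF word_mat_carrier[of A, OF assms]] by (simp add: word_mat_def)
next
  case (Cons x u)
  have "word_mat n A ((x # u) @ v) = A x * word_mat n A (u @ v)" by (simp add: word_mat_def)
  also have "\<dots> = (A x * word_mat n A u) * word_mat n A v"
    unfolding Cons by (rule assoc_mult_mat[symmetric, OF assms word_mat_carrier word_mat_carrier];
        rule assms)
  finally show ?case by (simp add: word_mat_def)
qed

lemma word_mat_single:
  assumes "\<And>x. A x \<in> carrier_mat n n"
  shows "word_mat n A [x] = A x"
  using one_mat_mult_right[OF assms] by (simp add: word_mat_def)

lemma matrix_morphism_word_mat:
  assumes "\<And>x. A x \<in> carrier_mat n n"
  shows "matrix_morphism X n (word_mat n A)"
  using word_mat_carrier[of A, OF assms] word_mat_append[of A, OF assms]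
  by (simp add: matrix_morphism_def word_mat_def[of _ _ "[]"])

section \<open>From invariant modules to matrices\<close>

text \<open>Let \<open>v(w)\<close> be the column of the values of the generators at
  \<open>w\<close>. The structure constants give \<open>v(xw) = A(x) v(w)\<close>, so
  \<open>v(w)\<close> is the word matrix times \<open>v(1)\<close>, and \<open>f\<close> is a fixed
  row times \<open>v\<close>.\<close>

lemma shift_invariant_imp_representation:
  fixes f :: "'x list \<Rightarrow> 'k::{semiring_0,monoid_mult}"
  assumes "right_shifts_in_fg_left_submodule X f"
  shows "has_linear_representation X f"
proof -
  obtain G where G: "finite G" "G \<subseteq> series X" and f: "f \<in> left_submodule X hull G"
    and st: "\<And>g x. g \<in> G \<Longrightarrow> x \<in> X \<Longrightarrow> right_shift [x] g \<in> left_submodule X hull G"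
    using assms unfolding right_shifts_in_fg_left_submodule_iff by blast
  obtain C where C: "\<And>f. f \<in> left_submodule X hull G \<Longrightarrow> f = (\<lambda>w. \<Sum>g\<in>G. C f g * g w)"
    using left_submodule_hull_coefficients[OF G] by blast
  define c where "c = (\<lambda>g x. C (right_shift [x] g))"
  have c: "g (x # w) = (\<Sum>h\<in>G. c g x h * h w)" if "g \<in> G" "x \<in> X" for g x w
    using fun_cong[OF C[OF st[OF that]], of w] by (simp add: c_def right_shift_def)
  define l where "l = C f"
  have l: "f w = (\<Sum>g\<in>G. l g * g w)" for w
    unfolding l_def by (rule fun_cong[OF C[OF f]])
  define n where "n = card G"
  obtain e where e: "bij_betw e {..<n} G"
    using ex_bij_betw_nat_finite[OF G(1)] by (auto simp: n_def atLeast0LessThan)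
  have eG: "e i \<in> G" if "i < n" for i using e that by (auto simp: bij_betw_def)
  have sum_e: "(\<Sum>g\<in>G. u g) = (\<Sum>i<n. u (e i))" for u :: "_ \<Rightarrow> 'k"
    using sum.reindex_bij_betw[OF e, of u] by simp
  \<comment> \<open>For \<open>x\<close> outside \<open>X\<close> the entries are unspecified but
    the dimensions are right; values are compared only at words over \<open>X\<close>.\<close>
  define A where "A = (\<lambda>x. mat n n (\<lambda>(i, j). c (e i) x (e j)))"
  define \<rho> where "\<rho> = mat 1 n (\<lambda>(i, j). l (e j))"
  define \<gamma> where "\<gamma> = mat n 1 (\<lambda>(i, j). e i [])"
  have A: "A x \<in> carrier_mat n n" for x by (simp add: A_def)
  have \<rho>: "\<rho> \<in> carrier_mat 1 n" and \<gamma>: "\<gamma> \<in> carrier_mat n 1" by (simp_all add: \<rho>_def \<gamma>_def)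
  note W = word_mat_carrier[of A, OF A]
  have W\<gamma>: "word_mat n A w * \<gamma> \<in> carrier_mat n 1" for w by (rule mult_carrier_mat[OF W \<gamma>])
  have ew: "e i w = (word_mat n A w * \<gamma>) $$ (i, 0)" if "w \<in> lists X" "i < n" for w i
    using that
  proof (induction arbitrary: i)
    case Nil
    then show ?case using one_mat_mult_left[OF \<gamma>] by (simp add: word_mat_def \<gamma>_def)
  next
    case (Cons x w)
    have "word_mat n A (x # w) * \<gamma> = A x * (word_mat n A w * \<gamma>)"
      using assoc_mult_mat[OF A W \<gamma>] by (simp add: word_mat_def)
    then have "(word_mat n A (x # w) * \<gamma>) $$ (i, 0) =
        (\<Sum>j<n. A x $$ (i, j) * (word_mat n A w * \<gamma>) $$ (j, 0))"
      using mult_mat_entry[OF A W\<gamma>] Cons.prems by simp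
    also have "\<dots> = (\<Sum>j<n. c (e i) x (e j) * e j w)"
      using Cons by (intro sum.cong) (simp_all add: A_def)
    also have "\<dots> = e i (x # w)"
      using c[OF eG[OF Cons.prems] Cons.hyps(1)] by (simp add: sum_e)
    finally show ?case by simp
  qed
  have "f w = (\<rho> * word_mat n A w * \<gamma>) $$ (0, 0)" if "w \<in> lists X" for w
  proof -
    have "(\<rho> * word_mat n A w * \<gamma>) $$ (0, 0) = (\<rho> * (word_mat n A w * \<gamma>)) $$ (0, 0)"
      using assoc_mult_mat[OF \<rho> W \<gamma>] by simp
    also have "\<dots> = (\<Sum>j<n. \<rho> $$ (0, j) * (word_mat n A w * \<gamma>) $$ (j, 0))"
      by (rule mult_mat_entry[OF \<rho> W\<gamma>]) simp_all
    also have "\<dots> = (\<Sum>j<n. l (e j) * e j w)"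
      using ew[OF that] by (intro sum.cong) (simp_all add: \<rho>_def)
    finally show ?thesis by (simp add: l sum_e)
  qed
  then show ?thesis
    unfolding has_linear_representation_def
    using \<rho> \<gamma> matrix_morphism_word_mat[of A, OF A] by blast
qed

text \<open>Dually, the values of the generators form a row, and appending a letter multiplies it by
  a matrix on the right.\<close>

lemma left_shift_invariant_imp_representation:
  fixes f :: "'x list \<Rightarrow> 'k::{semiring_0,monoid_mult}"
  assumes "left_shifts_in_fg_right_submodule X f"
  shows "has_linear_representation X f"
proof -
  obtain G where G: "finite G" "G \<subseteq> series X" and f: "f \<in> right_submodule X hull G"
    and st: "\<And>g x. g \<in> G \<Longrightarrow> x \<in> X \<Longrightarrow> left_shift [x] g \<in> right_submodule X hull G"
    using assms unfolding left_shifts_in_fg_right_submodule_iff by blast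
  obtain C where C: "\<And>f. f \<in> right_submodule X hull G \<Longrightarrow> f = (\<lambda>w. \<Sum>g\<in>G. g w * C f g)"
    using right_submodule_hull_coefficients[OF G] by blast
  define c where "c = (\<lambda>g x. C (left_shift [x] g))"
  have c: "g (w @ [x]) = (\<Sum>h\<in>G. h w * c g x h)" if "g \<in> G" "x \<in> X" for g x w
    using fun_cong[OF C[OF st[OF that]], of w] by (simp add: c_def left_shift_def)
  define l where "l = C f"
  have l: "f w = (\<Sum>g\<in>G. g w * l g)" for w
    unfolding l_def by (rule fun_cong[OF C[OF f]])
  define n where "n = card G"
  obtain e where e: "bij_betw e {..<n} G"
    using ex_bij_betw_nat_finite[OF G(1)] by (auto simp: n_def atLeast0LessThan)
  have eG: "e i \<in> G" if "i < n" for i using e that by (auto simp: bij_betw_def)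
  have sum_e: "(\<Sum>g\<in>G. u g) = (\<Sum>i<n. u (e i))" for u :: "_ \<Rightarrow> 'k"
    using sum.reindex_bij_betw[OF e, of u] by simp
  \<comment> \<open>Column \<open>j\<close> holds the coefficients of the shift of
    \<open>e j\<close>, since the matrix now acts on rows.\<close>
  define A where "A = (\<lambda>x. mat n n (\<lambda>(i, j). c (e j) x (e i)))"
  define \<rho> where "\<rho> = mat 1 n (\<lambda>(i, j). e j [])"
  define \<gamma> where "\<gamma> = mat n 1 (\<lambda>(i, j). l (e i))"
  have A: "A x \<in> carrier_mat n n" for x by (simp add: A_def)
  have \<rho>: "\<rho> \<in> carrier_mat 1 n" and \<gamma>: "\<gamma> \<in> carrier_mat n 1" by (simp_all add: \<rho>_def \<gamma>_def)
  note W = word_mat_carrier[of A, OF A]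
  have \<rho>W: "\<rho> * word_mat n A w \<in> carrier_mat 1 n" for w by (rule mult_carrier_mat[OF \<rho> W])
  have ew: "e i w = (\<rho> * word_mat n A w) $$ (0, i)" if "w \<in> lists X" "i < n" for w i
    using that
  \<comment> \<open>Left shifts detach the last letter, hence induction from the end of the
    word.\<close>
  proof (induction w arbitrary: i rule: rev_induct)
    case Nil
    then show ?case using one_mat_mult_right[OF \<rho>] by (simp add: word_mat_def \<rho>_def)
  next
    case (snoc x w)
    then have x: "x \<in> X" and w: "w \<in> lists X" by auto
    have "\<rho> * word_mat n A (w @ [x]) = (\<rho> * word_mat n A w) * A x"
      using assoc_mult_mat[OF \<rho> W A] by (simp add: word_mat_append[OF A] word_mat_single[OF A])
    then have "(\<rho> * word_mat n A (w @ [x])) $$ (0, i) =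
        (\<Sum>j<n. (\<rho> * word_mat n A w) $$ (0, j) * A x $$ (j, i))"
      using mult_mat_entry[OF \<rho>W A] snoc.prems by simp
    also have "\<dots> = (\<Sum>j<n. e j w * c (e i) x (e j))"
      using snoc.IH[OF w] snoc.prems by (intro sum.cong) (simp_all add: A_def)
    also have "\<dots> = e i (w @ [x])"
      using c[OF eG[OF snoc.prems(2)] x] by (simp add: sum_e)
    finally show ?case by simp
  qed
  have "f w = (\<rho> * word_mat n A w * \<gamma>) $$ (0, 0)" if "w \<in> lists X" for w
  proof -
    have "(\<rho> * word_mat n A w * \<gamma>) $$ (0, 0) =
        (\<Sum>j<n. (\<rho> * word_mat n A w) $$ (0, j) * \<gamma> $$ (j, 0))"
      by (rule mult_mat_entry[OF \<rho>W \<gamma>]) simp_all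
    also have "\<dots> = (\<Sum>j<n. e j w * l (e j))"
      using ew[OF that] by (intro sum.cong) (simp_all add: \<gamma>_def)
    finally show ?thesis by (simp add: l sum_e)
  qed
  then show ?thesis
    unfolding has_linear_representation_def
    using \<rho> \<gamma> matrix_morphism_word_mat[of A, OF A] by blast
qed

section \<open>From matrices to invariant modules\<close>

text \<open>The entries of the column \<open>\<mu> w * \<gamma>\<close>, as functions of
  \<open>w\<close>, generate the module: a letter \<open>x\<close> shifts them through
  \<open>\<mu> [x]\<close>, and \<open>\<rho>\<close> gives the coefficients of
  \<open>f\<close>.\<close>

lemma representation_imp_shift_invariant:
  fixes f :: "'x list \<Rightarrow> 'k::{semiring_0,monoid_mult}"
  assumes "has_linear_representation X f" and fX: "f \<in> series X"
  shows "right_shifts_in_fg_left_submodule X f"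
proof -
  obtain n \<rho> \<gamma> \<mu> where \<rho>: "\<rho> \<in> carrier_mat 1 n" and \<gamma>: "\<gamma> \<in> carrier_mat n 1"
    and \<mu>: "matrix_morphism X n \<mu>" and f: "\<And>w. w \<in> lists X \<Longrightarrow> f w = (\<rho> * \<mu> w * \<gamma>) $$ (0, 0)"
    using assms(1) unfolding has_linear_representation_def by blast
  have M: "\<mu> w \<in> carrier_mat n n" if "w \<in> lists X" for w
    using \<mu> that by (simp add: matrix_morphism_def)
  define g where "g = (\<lambda>i w. if w \<in> lists X then (\<mu> w * \<gamma>) $$ (i, 0) else 0)"
  define G where "G = g ` {..<n}"
  have "g i \<in> series X" for i by (simp add: g_def series_def)
  then have G: "finite G" "G \<subseteq> series X" by (auto simp: G_def)
  note N = left_submodule_hull[OF G(2)]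
  have gN: "g i \<in> left_submodule X hull G" if "i \<in> {..<n}" for i
    using that by (intro hull_inc) (simp add: G_def)
  have shift_g: "right_shift [x] (g i) = (\<lambda>w. \<Sum>j<n. \<mu> [x] $$ (i, j) * g j w)" if "i < n" "x \<in> X" for i x
  proof
    fix w
    show "right_shift [x] (g i) w = (\<Sum>j<n. \<mu> [x] $$ (i, j) * g j w)"
    proof (cases "w \<in> lists X")
      case True
      have x: "[x] \<in> lists X" using that by simp
      have "\<mu> (x # w) = \<mu> [x] * \<mu> w"
        using \<mu> x True unfolding matrix_morphism_def by (metis append_Cons append_Nil)
      then have "\<mu> (x # w) * \<gamma> = \<mu> [x] * (\<mu> w * \<gamma>)"
        using assoc_mult_mat[OF M[OF x] M[OF True] \<gamma>] by simp
      then show ?thesis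
        using mult_mat_entry[OF M[OF x] mult_carrier_mat[OF M[OF True] \<gamma>], of i 0] that True
        by (simp add: right_shift_def g_def)
    qed (simp add: right_shift_def g_def)
  qed
  have "right_shift [x] (g i) \<in> left_submodule X hull G" if "i < n" "x \<in> X" for i x
    unfolding shift_g[OF that] by (rule left_submodule_sum[OF N gN])
  then have "\<forall>h\<in>G. \<forall>x\<in>X. right_shift [x] h \<in> left_submodule X hull G"
    by (auto simp: G_def)
  moreover have "f = (\<lambda>w. \<Sum>i<n. \<rho> $$ (0, i) * g i w)"
  proof
    fix w show "f w = (\<Sum>i<n. \<rho> $$ (0, i) * g i w)"
    proof (cases "w \<in> lists X")
      case True
      have "f w = (\<rho> * (\<mu> w * \<gamma>)) $$ (0, 0)"
        using f[OF True] assoc_mult_mat[OF \<rho> M[OF True] \<gamma>] by simp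
      then show ?thesis
        using mult_mat_entry[OF \<rho> mult_carrier_mat[OF M[OF True] \<gamma>], of 0 0] True
        by (simp add: g_def)
    qed (use fX in \<open>simp add: series_def g_def\<close>)
  qed
  then have "f \<in> left_submodule X hull G"
    by (rule ssubst) (rule left_submodule_sum[OF N gN])
  ultimately show ?thesis unfolding right_shifts_in_fg_left_submodule_iff using G by blast
qed

text \<open>Here the entries of the row \<open>\<rho> * \<mu> w\<close> generate, and
  \<open>\<gamma>\<close> gives the coefficients of \<open>f\<close>.\<close>

lemma representation_imp_left_shift_invariant:
  fixes f :: "'x list \<Rightarrow> 'k::{semiring_0,monoid_mult}"
  assumes "has_linear_representation X f" and fX: "f \<in> series X"
  shows "left_shifts_in_fg_right_submodule X f"
proof -
  obtain n \<rho> \<gamma> \<mu> where \<rho>: "\<rho> \<in> carrier_mat 1 n" and \<gamma>: "\<gamma> \<in> carrier_mat n 1"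
    and \<mu>: "matrix_morphism X n \<mu>" and f: "\<And>w. w \<in> lists X \<Longrightarrow> f w = (\<rho> * \<mu> w * \<gamma>) $$ (0, 0)"
    using assms(1) unfolding has_linear_representation_def by blast
  have M: "\<mu> w \<in> carrier_mat n n" if "w \<in> lists X" for w
    using \<mu> that by (simp add: matrix_morphism_def)
  define g where "g = (\<lambda>i w. if w \<in> lists X then (\<rho> * \<mu> w) $$ (0, i) else 0)"
  define G where "G = g ` {..<n}"
  have "g i \<in> series X" for i by (simp add: g_def series_def)
  then have G: "finite G" "G \<subseteq> series X" by (auto simp: G_def)
  note N = right_submodule_hull[OF G(2)]
  have gN: "g i \<in> right_submodule X hull G" if "i \<in> {..<n}" for i
    using that by (intro hull_inc) (simp add: G_def)
  have shift_g: "left_shift [x] (g i) = (\<lambda>w. \<Sum>j<n. g j w * \<mu> [x] $$ (j, i))" if "i < n" "x \<in> X" for i x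
  proof
    fix w
    show "left_shift [x] (g i) w = (\<Sum>j<n. g j w * \<mu> [x] $$ (j, i))"
    proof (cases "w \<in> lists X")
      case True
      have x: "[x] \<in> lists X" using that by simp
      have "\<mu> (w @ [x]) = \<mu> w * \<mu> [x]"
        using \<mu> x True unfolding matrix_morphism_def by blast
      then have "\<rho> * \<mu> (w @ [x]) = (\<rho> * \<mu> w) * \<mu> [x]"
        using assoc_mult_mat[OF \<rho> M[OF True] M[OF x]] by simp
      then show ?thesis
        using mult_mat_entry[OF mult_carrier_mat[OF \<rho> M[OF True]] M[OF x], of 0 i] that True
        by (simp add: left_shift_def g_def)
    qed (simp add: left_shift_def g_def)
  qed
  have "left_shift [x] (g i) \<in> right_submodule X hull G" if "i < n" "x \<in> X" for i x
    unfolding shift_g[OF that] by (rule right_submodule_sum[OF N gN])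
  then have "\<forall>h\<in>G. \<forall>x\<in>X. left_shift [x] h \<in> right_submodule X hull G"
    by (auto simp: G_def)
  moreover have "f = (\<lambda>w. \<Sum>i<n. g i w * \<gamma> $$ (i, 0))"
  proof
    fix w show "f w = (\<Sum>i<n. g i w * \<gamma> $$ (i, 0))"
    proof (cases "w \<in> lists X")
      case True
      then show ?thesis
        using mult_mat_entry[OF mult_carrier_mat[OF \<rho> M[OF True]] \<gamma>, of 0 0] f
        by (simp add: g_def)
    qed (use fX in \<open>simp add: series_def g_def\<close>)
  qed
  then have "f \<in> right_submodule X hull G"
    by (rule ssubst) (rule right_submodule_sum[OF N gN])
  ultimately show ?thesis unfolding left_shifts_in_fg_right_submodule_iff using G by blast
qed

text \<open>Conditions (i) and (ii) are each linked to (iii), and (iv) to (i). A representation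
  speaks only of words over \<open>X\<close>; in the passages from (iii), membership in
  \<open>series X\<close> settles the other values of \<open>f\<close>.\<close>

theorem theorem4p5:
  fixes X :: "'x set" and f :: "'x list \<Rightarrow> 'k::{semiring_0,monoid_mult}"
  assumes "f \<in> series X"
  shows "(right_shifts_in_fg_left_submodule X f \<longleftrightarrow> left_shifts_in_fg_right_submodule X f) \<and>
         (left_shifts_in_fg_right_submodule X f \<longleftrightarrow> has_linear_representation X f) \<and>
         (has_linear_representation X f \<longleftrightarrow> f \<in> rational_closure X (letter_series_space X))"
  using assms shift_invariant_imp_representation left_shift_invariant_imp_representation
    representation_imp_shift_invariant representation_imp_left_shift_invariant
    shift_invariant_imp_rational rational_imp_shift_invariant
  by blast

end
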